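(* Let $R$ be an integral domain with quotient field $K$ such that every irreducible element of $R[x]$ of degree greater than or equal to $1$ is irreducible in $K[x]$. If $\rho(R)$ is defined (that is, if $R$ has at least one atom), then $\rho(R) = \rho(R[x])$.
   Context: For an integral domain $D$, an atom is an irreducible element (a nonzero nonunit that is not a product of two nonunits). $\mathrm{A}(D)$ denotes the set of elements of $D$ that can be expressed as a product of atoms. For a nonzero nonunit $a \in \mathrm{A}(D)$, the elasticity of $a$ is $\rho(a) = \sup\{ n/m : a = \pi_1\cdots\pi_n = \xi_1\cdots\xi_m \text{ with all } \pi_i, \xi_j \text{ irreducible in } D\}$. The elasticity of $D$ is $\rho(D) = \sup\{\rho(a) : a \in \mathrm{A}(D)\text{ a nonzero nonunit}\} \in [1,\infty]$; it is undefined if $D$ has no atoms. $D$ is not assumed to be atomic. *)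

theory Defs
  imports
    "HOL-Computational_Algebra.Polynomial_Factorial"
    "HOL-Library.Extended_Real"
begin

definition atomic_factorization :: "'a::idom \<Rightarrow> 'a list \<Rightarrow> bool" where
  "atomic_factorization a ps \<longleftrightarrow> (\<forall>p\<in>set ps. irreducible p) \<and> a = prod_list ps"

text \<open>
  The set \<open>A(D)\<close>. It contains \<open>1\<close> as the empty product; this is immaterial, since only the
  nonzero nonunits in it are ever considered.
\<close>
definition atom_products :: "'a::idom set" where
  "atom_products = {a. \<exists>ps. atomic_factorization a ps}"

text \<open>
  Meaningful only for a nonunit \<open>a\<close> in \<^const>\<open>atom_products\<close>: then every factorization into
  atoms is nonempty, so no denominator vanishes, and the supremum is over a nonempty set.
\<close>
definition elasticity_of :: "'a::idom \<Rightarrow> ereal" where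
  "elasticity_of a =
     Sup {ereal (real (length ps) / real (length qs)) | ps qs.
            atomic_factorization a ps \<and> atomic_factorization a qs}"

text \<open>
  The elasticity of the domain \<open>'a\<close>. If there are no atoms, it is mathematically undefined
  (the supremum below is over the empty set), so statements about it have to assume an atom.
\<close>
definition elasticity :: "'a::idom itself \<Rightarrow> ereal" where
  "elasticity _ =
     Sup {elasticity_of a | a :: 'a. a \<in> atom_products \<and> a \<noteq> 0 \<and> \<not> a dvd 1}"

end

(*
  Up to associates, the atoms of R[x] of positive degree are determined by their images in K[x].
  Suppose that g and h are two of them and g = (a/b) h in K[x].  For N > deg g the polynomial
  F = g + x^N h = h (a/b + x^N) has no nonunit constant divisor in R[x], so a divisor p of F of
  minimal degree among those divisible by h in K[x] is an atom.  By the hypothesis p is irreducible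
  in K[x], whence h = v p with v the leading coefficient of F/p; thus v is a unit, and the constant
  coefficient of F/p yields a/b in R.  Consequently two factorizations of an element of R[x]
  into atoms have, up to units, the same factors of positive degree, and their constant factors
  give two factorizations of an element of R.  Equally many further factors on both sides only
  move a ratio of lengths towards 1.
*)

theory Submission
  imports Defs
begin

section \<open>Polynomials over R and over its quotient field K\<close>

lemma prime_elem_dvd_prod_listD:
  assumes "prime_elem p" "p dvd prod_list xs"
  shows "\<exists>x\<in>set xs. p dvd x"
  using assms(2) by (induction xs) (use assms(1) in \<open>auto simp: prime_elem_dvd_mult_iff prime_elem_not_unit\<close>)

lemma fract_poly_prod_list:
  fixes ps :: "'a::idom poly list"
  shows "map_poly to_fract (prod_list ps) = prod_list (map (map_poly to_fract) ps)"
  by (induction ps) simp_all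

text \<open>The cofactor is a unit of K[x], so it is a constant fraction a/b; multiplying by b turns
  the relation into one in R[x].\<close>

lemma fract_poly_dvd_irreducibleE:
  fixes g h :: "'a::idom poly"
  assumes "irreducible (map_poly to_fract g)" "\<not> map_poly to_fract h dvd 1"
    and "map_poly to_fract h dvd map_poly to_fract g"
  obtains a b where "a \<noteq> 0" "b \<noteq> 0" "smult b g = smult a h"
proof -
  obtain k where k: "map_poly to_fract g = map_poly to_fract h * k"
    using assms(3) by blast
  with assms(1,2) have "k dvd 1" by (metis irreducibleD)
  then obtain c where "k = [:c:]" "c dvd 1" by (rule is_unit_polyE)
  then have c: "k = [:c:]" "c \<noteq> 0" by auto
  obtain a b where ab: "c = Fract a b" "b \<noteq> 0"
    by (cases c) auto
  have eq: "map_poly to_fract g = smult (to_fract a / to_fract b) (map_poly to_fract h)"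
    using k c ab by (simp add: Fract_conv_to_fract)
  have "map_poly to_fract (smult b g) = map_poly to_fract (smult a h)"
    unfolding fract_poly_smult eq using ab(2) by simp
  then have "smult b g = smult a h" by (simp only: fract_poly_eq_iff)
  moreover have "a \<noteq> 0"
    using ab c(2) by (auto simp: Fract_conv_to_fract)
  ultimately show thesis using that ab(2) by blast
qed

text \<open>The cofactor has positive degree and so is no unit of R[x]; irreducibility leaves only
  the constant.\<close>

lemma const_dvd_irreducible_poly:
  fixes f :: "'a::idom poly"
  assumes "irreducible f" "degree f \<ge> 1" "[:c:] dvd f"
  shows "c dvd 1"
proof -
  obtain k where k: "f = [:c:] * k" using assms(3) by blast
  then have "[:c:] dvd 1 \<or> k dvd 1" using assms(1) by (metis irreducibleD)
  moreover have "\<not> k dvd 1"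
    using k assms(2) by (auto simp: is_unit_poly_iff split: if_splits)
  ultimately show ?thesis by (simp add: is_unit_const_poly_iff)
qed

lemma fract_poly_not_unit:
  fixes f :: "'a::idom poly"
  assumes "degree f \<ge> 1"
  shows "\<not> map_poly to_fract f dvd 1"
proof
  assume "map_poly to_fract f dvd 1"
  then have "degree (map_poly to_fract f) = 0" by (auto simp: is_unit_poly_iff)
  then show False using assms by (simp add: degree_map_poly)
qed

section \<open>Atoms of positive degree: divisibility over K and over R\<close>

text \<open>R[x] need not be atomic, so minimality of degree replaces a factorization of
  \<open>F\<close>. If \<open>p = r * s\<close>, primality over K lets \<open>h\<close> divide one
  of the factors; by minimality the other has degree 0, and constant divisors of \<open>F\<close>
  are units.\<close>

lemma irreducible_divisor_of_primitive_multiple: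
  fixes h F :: "'a::idom poly"
  assumes "prime_elem (map_poly to_fract h)" "F \<noteq> 0" "degree h \<ge> 1"
    and primitive: "\<And>c. [:c:] dvd F \<Longrightarrow> c dvd 1"
    and "map_poly to_fract h dvd map_poly to_fract F"
  obtains p where "irreducible p" "p dvd F" "map_poly to_fract h dvd map_poly to_fract p"
proof -
  define P where "P p \<longleftrightarrow> p dvd F \<and> map_poly to_fract h dvd map_poly to_fract p" for p
  have "P F" using assms(5) by (simp add: P_def)
  then obtain p where p: "P p" and minimal: "\<And>q. P q \<Longrightarrow> degree p \<le> degree q"
    using ex_has_least_nat[of P F degree] by blast
  have dvd: "p dvd F" "map_poly to_fract h dvd map_poly to_fract p"
    using p by (auto simp: P_def)
  have "p \<noteq> 0" using dvd(1) assms(2) by auto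
  have aux: "s dvd 1" if "p = r * s" "map_poly to_fract h dvd map_poly to_fract r" for r s
  proof -
    have "P r" using that dvd(1) by (auto simp: P_def intro: dvd_trans)
    then have "degree p \<le> degree r" by (rule minimal)
    moreover have "degree p = degree r + degree s"
      using that(1) \<open>p \<noteq> 0\<close> by (auto simp: degree_mult_eq)
    ultimately obtain c where c: "s = [:c:]" using degree_eq_zeroE[of s] by auto
    then have "[:c:] dvd F" using that(1) dvd(1) by (metis dvd_mult_right)
    then show ?thesis using primitive c by (simp add: is_unit_const_poly_iff)
  qed
  have "irreducible p"
  proof (rule irreducibleI)
    show "\<not> p dvd 1"
      using dvd(2) fract_poly_not_unit[OF assms(3)] fract_poly_is_unit[of p] dvd_trans by blast
  next
    fix r s assume rs: "p = r * s"
    then have "map_poly to_fract h dvd map_poly to_fract r * map_poly to_fract s"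
      using dvd(2) by simp
    then consider "map_poly to_fract h dvd map_poly to_fract r"
      | "map_poly to_fract h dvd map_poly to_fract s"
      using assms(1) by (auto simp: prime_elem_dvd_mult_iff)
    then show "r dvd 1 \<or> s dvd 1"
      using aux[of r s] aux[of s r] rs by (cases; simp add: mult.commute)
  qed (fact \<open>p \<noteq> 0\<close>)
  with dvd that show thesis by blast
qed

text \<open>Over K the quotient of \<open>g\<close> by \<open>h\<close> is a fraction a/b; the point
  is that b divides a. This comes from applying \<open>H\<close> to a third atom, a divisor of the
  auxiliary polynomial \<open>F\<close>.\<close>

lemma irreducible_dvd_of_fract_poly_dvd:
  fixes g h :: "'a::idom poly"
  assumes H: "\<And>f :: 'a poly. irreducible f \<Longrightarrow> degree f \<ge> 1 \<Longrightarrow> irreducible (map_poly to_fract f)"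
    and g: "irreducible g" "degree g \<ge> 1" and h: "irreducible h" "degree h \<ge> 1"
    and dvd: "map_poly to_fract h dvd map_poly to_fract g"
  shows "h dvd g"
proof -
  obtain a b where ab: "a \<noteq> 0" "b \<noteq> 0" "smult b g = smult a h"
    using fract_poly_dvd_irreducibleE[OF H[OF g] fract_poly_not_unit[OF h(2)] dvd] .
  \<comment> \<open>As \<open>N\<close> exceeds the degree of \<open>g\<close>, the low coefficients
    of \<open>F\<close> are those of \<open>g\<close>, so a constant dividing \<open>F\<close>
    divides \<open>g\<close> and is a unit. As \<open>N\<close> is positive, the two terms of
    \<open>monom b N + [:a:]\<close> do not overlap.\<close>
  define N where "N = Suc (degree g)"
  define F where "F = g + monom 1 N * h"
  have coeff_F: "coeff F n = coeff g n" if "n \<le> degree g" for n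
    using that by (simp add: F_def coeff_monom_mult N_def)
  have primitive: "c dvd 1" if "[:c:] dvd F" for c
  proof (rule const_dvd_irreducible_poly[OF g])
    have "c dvd coeff g n" for n
      using that coeff_F[of n] by (cases "n \<le> degree g") (auto simp: const_poly_dvd_iff coeff_eq_0 dest: spec[of _ n])
    then show "[:c:] dvd g" by (simp add: const_poly_dvd_iff)
  qed
  have "F \<noteq> 0" using coeff_F[of "degree g"] g(2) by auto
  have "prime_elem (map_poly to_fract h)"
    using H[OF h] by (rule field_poly_irreducible_imp_prime)
  moreover have "map_poly to_fract h dvd map_poly to_fract F"
    using dvd by (simp add: F_def)
  ultimately obtain p where p: "irreducible p" "p dvd F" "map_poly to_fract h dvd map_poly to_fract p"
    using irreducible_divisor_of_primitive_multiple[of h F] \<open>F \<noteq> 0\<close> h(2) primitive by metis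
  have deg_p: "degree p \<ge> 1"
  proof (rule ccontr)
    assume "\<not> degree p \<ge> 1"
    then obtain c where "p = [:c:]" using degree_eq_zeroE[of p] by auto
    then have "p dvd 1" using primitive p(2) by (simp add: is_unit_const_poly_iff)
    then show False using p(1) by (simp add: irreducible_def)
  qed
  obtain r s where rs: "r \<noteq> 0" "s \<noteq> 0" "smult s p = smult r h"
    using fract_poly_dvd_irreducibleE[OF H[OF p(1) deg_p] fract_poly_not_unit[OF h(2)] p(3)] .
  obtain q where q: "F = p * q" using p(2) by blast
  \<comment> \<open>Since \<open>smult b g = smult a h\<close>, the multiple
    \<open>smult b F\<close> is \<open>h\<close> times a binomial. Writing
    \<open>smult (s * b) F\<close> in two ways and cancelling \<open>h\<close> shows that the
    cofactor \<open>q\<close> of \<open>p\<close> is proportional to that binomial.\<close>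
  have "h * smult (b * r) q = smult b (smult r h * q)" by simp
  also have "\<dots> = smult s (smult b F)"
    by (simp add: rs(3)[symmetric] q mult.commute)
  also have "smult b F = h * (monom b N + [:a:])"
  proof -
    have "smult b (monom 1 N * h) = h * monom b N"
      by (metis mult.commute mult.right_neutral mult_smult_right smult_monom)
    then show ?thesis by (simp add: F_def smult_add_right ab(3) distrib_left)
  qed
  finally have "h * smult (b * r) q = h * smult s (monom b N + [:a:])" by simp
  then have eq: "smult (b * r) q = smult s (monom b N + [:a:])"
    using h(2) by (metis degree_0 mult_left_cancel not_one_le_zero)
  \<comment> \<open>Comparing coefficients at \<open>N\<close> gives \<open>s = r * v\<close>, hence
    \<open>h = smult v p\<close>, and \<open>v\<close> is a unit because \<open>h\<close> is an atom
    of positive degree.\<close>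
  define v where "v = coeff q N"
  have "b * r * v = s * b"
    using arg_cong[OF eq, of "\<lambda>f. coeff f N"] by (simp add: v_def N_def)
  then have s: "s = r * v" using ab(2) by (simp add: mult.commute mult.left_commute)
  have h_eq: "h = smult v p"
  proof -
    have "smult r (smult v p) = smult r h" using rs(3) s by simp
    then show ?thesis using rs(1) by (simp add: poly_eq_iff)
  qed
  then have "h = [:v:] * p" by simp
  then have "[:v:] dvd h" by (rule dvdI)
  then have "v dvd 1" using const_dvd_irreducible_poly[OF h] by blast
  then obtain w where w: "1 = v * w" by blast
  \<comment> \<open>The constant coefficients exhibit \<open>v * a\<close> as a multiple of
    \<open>b\<close>; as \<open>v\<close> is a unit, a/b lies in R.\<close>
  have "r * (b * coeff q 0) = r * (v * a)"
    using arg_cong[OF eq, of "\<lambda>f. coeff f 0"] s by (simp add: N_def mult_ac)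
  then have "b * coeff q 0 = v * a" using rs(1) by simp
  then have a: "a = b * (coeff q 0 * w)"
    using w by (metis mult.assoc mult.commute mult.right_neutral)
  have "smult b g = smult b (smult (coeff q 0 * w) h)" using ab(3) a by simp
  then have "g = smult (coeff q 0 * w) h" using ab(2) by (simp add: poly_eq_iff)
  then show ?thesis by (metis dvd_smult dvd_refl)
qed

section \<open>Matching two factorizations in R[x]\<close>

text \<open>Each \<open>g\<close> is prime over K, so it divides some \<open>h\<close> there, hence
  also in R[x], and the two atoms are associated. The arbitrary constants \<open>c\<close> and
  \<open>d\<close> let the induction absorb the units that arise; \<open>u\<close> later serves to
  compare the constant parts.\<close>

lemma nonconstant_irreducible_lists_associated:
  fixes gs hs :: "'a::idom poly list"
  assumes H: "\<And>f :: 'a poly. irreducible f \<Longrightarrow> degree f \<ge> 1 \<Longrightarrow> irreducible (map_poly to_fract f)"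
    and "\<forall>g\<in>set gs. irreducible g \<and> degree g \<ge> 1" "\<forall>h\<in>set hs. irreducible h \<and> degree h \<ge> 1"
    and "c \<noteq> 0" "d \<noteq> 0" "smult c (prod_list gs) = smult d (prod_list hs)"
  shows "length gs = length hs \<and> (\<exists>u. u dvd 1 \<and> prod_list hs = smult u (prod_list gs))"
  using assms(2-)
proof (induction gs arbitrary: hs c d)
  case Nil
  \<comment> \<open>A member of \<open>hs\<close> would divide the nonzero constant
    \<open>c\<close>, contrary to its positive degree.\<close>
  have "hs = []"
  proof (cases hs)
    case (Cons h hs')
    have "prod_list hs dvd [:c:]"
      using Nil.prems(5) by (metis dvd_refl dvd_smult prod_list.Nil smult_one)
    then have "h dvd [:c:]" using Cons by (simp add: dvd_mult_left)
    then have "degree h \<le> 0" using Nil.prems(3) dvd_imp_degree_le[of h "[:c:]"] by simp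
    then show ?thesis using Nil.prems(2) Cons by simp
  qed simp
  then show ?case by (auto intro: exI[of _ 1])
next
  case (Cons g gs)
  have g: "irreducible g" "degree g \<ge> 1" using Cons.prems(1) by auto
  have prime: "prime_elem (map_poly to_fract g)"
    using H[OF g] by (rule field_poly_irreducible_imp_prime)
  have "g dvd smult d (prod_list hs)"
    using Cons.prems(5) by (metis dvd_smult dvd_triv_left prod_list.Cons)
  then have "map_poly to_fract g dvd smult (to_fract d) (map_poly to_fract (prod_list hs))"
    by (metis fract_poly_dvd fract_poly_smult)
  then have "map_poly to_fract g dvd prod_list (map (map_poly to_fract) hs)"
    using Cons.prems(4) by (simp add: dvd_smult_iff fract_poly_prod_list)
  from prime_elem_dvd_prod_listD[OF prime this]
  obtain h where h: "h \<in> set hs" "map_poly to_fract g dvd map_poly to_fract h"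
    by auto
  have h': "irreducible h" "degree h \<ge> 1" using h(1) Cons.prems(2) by auto
  have "g dvd h" using irreducible_dvd_of_fract_poly_dvd[OF H h' g h(2)] .
  then obtain k where k: "h = g * k" by blast
  then have "k dvd 1" using h'(1) g(1) by (metis irreducibleD irreducible_def)
  then obtain e where e: "k = [:e:]" "e dvd 1" by (auto simp: is_unit_poly_iff)
  then have h_eq: "h = smult e g" using k by simp
  obtain xs ys where hs: "hs = xs @ h # ys" using h(1) by (meson split_list)
  \<comment> \<open>After cancelling \<open>g\<close> against its associate \<open>h\<close>, the
    unit \<open>e\<close> joins the constant in front of the remaining product.\<close>
  have "g * smult c (prod_list gs) = g * smult (d * e) (prod_list (xs @ ys))"
    using Cons.prems(5) by (simp add: hs h_eq algebra_simps)
  then have "smult c (prod_list gs) = smult (d * e) (prod_list (xs @ ys))"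
    using g(2) by (metis degree_0 mult_left_cancel not_one_le_zero)
  moreover have "d * e \<noteq> 0" using e(2) Cons.prems(4) by auto
  ultimately have IH: "length gs = length (xs @ ys)"
    "\<exists>u. u dvd 1 \<and> prod_list (xs @ ys) = smult u (prod_list gs)"
    using Cons.IH[of "xs @ ys" c "d * e"] Cons.prems(1,2,3) hs by auto
  then obtain u where u: "u dvd 1" "prod_list (xs @ ys) = smult u (prod_list gs)" by blast
  have "prod_list hs = smult e (g * prod_list (xs @ ys))"
    by (simp add: hs h_eq algebra_simps)
  then have "prod_list hs = smult (e * u) (prod_list (g # gs))"
    by (simp only: u(2)) simp
  moreover have "e * u dvd 1" using mult_dvd_mono[OF e(2) u(1)] by simp
  ultimately show ?case using IH(1) hs by auto
qed

text \<open>The constant factors are returned as atoms of R, so that their number can be measured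
  against the elasticity of R.\<close>

lemma poly_factorization_split_constants:
  fixes ps :: "'a::idom poly list"
  assumes "\<forall>p\<in>set ps. irreducible p"
  shows "\<exists>cs gs. (\<forall>c\<in>set cs. irreducible c) \<and> (\<forall>g\<in>set gs. irreducible g \<and> degree g \<ge> 1) \<and>
    prod_list ps = smult (prod_list cs) (prod_list gs) \<and> length ps = length cs + length gs"
  using assms
proof (induction ps)
  case Nil
  show ?case by (rule exI[of _ "[]"], rule exI[of _ "[]"]) simp
next
  case (Cons p ps)
  then obtain cs gs where IH: "\<forall>c\<in>set cs. irreducible c" "\<forall>g\<in>set gs. irreducible g \<and> degree g \<ge> 1"
    "prod_list ps = smult (prod_list cs) (prod_list gs)" "length ps = length cs + length gs"
    by auto
  show ?case
  proof (cases "degree p \<ge> 1")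
    case True
    with IH Cons.prems show ?thesis
      by (intro exI[of _ cs] exI[of _ "p # gs"]) simp
  next
    case False
    then obtain c where c: "p = [:c:]" using degree_eq_zeroE[of p] by auto
    then have "irreducible c" using Cons.prems by (simp add: irreducible_const_poly_iff)
    with IH c show ?thesis
      by (intro exI[of _ "c # cs"] exI[of _ gs]) (simp add: mult.commute)
  qed
qed

section \<open>Elasticity as a bound on ratios of lengths\<close>

lemma prod_list_irreducible_neq_0:
  fixes ps :: "'a::idom list"
  shows "\<forall>p\<in>set ps. irreducible p \<Longrightarrow> prod_list ps \<noteq> 0"
  by (auto simp: prod_list_zero_iff)

lemma prod_list_irreducible_dvd_1_iff:
  fixes ps :: "'a::idom list"
  shows "\<forall>p\<in>set ps. irreducible p \<Longrightarrow> prod_list ps dvd 1 \<longleftrightarrow> ps = []"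
  by (cases ps) (auto simp: irreducible_def dest: dvd_mult_left)

text \<open>With \<open>elasticity_leI\<close> this replaces the nested suprema by pairs of lists. A
  nonempty list of atoms has a nonzero nonunit as product, which the outer supremum therefore
  covers.\<close>

lemma length_ratio_le_elasticity:
  fixes ps qs :: "'a::idom list"
  assumes "\<forall>p\<in>set ps. irreducible p" "\<forall>q\<in>set qs. irreducible q" "prod_list ps = prod_list qs"
    and "ps \<noteq> []"
  shows "ereal (real (length ps) / real (length qs)) \<le> elasticity TYPE('a)"
proof -
  have "ereal (real (length ps) / real (length qs)) \<le> elasticity_of (prod_list ps)"
    unfolding elasticity_of_def using assms(1-3)
    by (intro Sup_upper CollectI exI[of _ ps] exI[of _ qs]) (simp add: atomic_factorization_def)
  also have "\<dots> \<le> elasticity TYPE('a)"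
    unfolding elasticity_def using assms prod_list_irreducible_neq_0[of ps]
      prod_list_irreducible_dvd_1_iff[of ps]
    by (intro Sup_upper) (auto simp: atom_products_def atomic_factorization_def)
  finally show ?thesis .
qed

lemma elasticity_leI:
  assumes "\<And>ps qs :: 'a::idom list. \<lbrakk>\<forall>p\<in>set ps. irreducible p; \<forall>q\<in>set qs. irreducible q;
      prod_list ps = prod_list qs; ps \<noteq> []; qs \<noteq> []\<rbrakk>
      \<Longrightarrow> ereal (real (length ps) / real (length qs)) \<le> B"
  shows "elasticity TYPE('a) \<le> B"
proof -
  have "ereal (real (length ps) / real (length qs)) \<le> B"
    if "atomic_factorization a ps" "atomic_factorization a qs" "\<not> a dvd 1" for a :: 'a and ps qs
    using that by (intro assms) (auto simp: atomic_factorization_def)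
  then show ?thesis
    unfolding elasticity_def elasticity_of_def by (intro Sup_least) (auto intro!: Sup_least)
qed

text \<open>The existence of an atom enters here; without one the supremum is over the empty
  set.\<close>

lemma one_le_elasticity:
  assumes "irreducible (p :: 'a::idom)"
  shows "1 \<le> elasticity TYPE('a)"
  using length_ratio_le_elasticity[of "[p]" "[p]"] assms by (simp add: one_ereal_def)

text \<open>The unit is absorbed into the first atom of \<open>qs\<close>, which leaves the length
  unchanged. If \<open>qs\<close> were empty, the product of \<open>ps\<close> would be a
  unit.\<close>

lemma length_ratio_le_elasticity_associated:
  fixes ps qs :: "'a::idom list"
  assumes "\<forall>p\<in>set ps. irreducible p" "\<forall>q\<in>set qs. irreducible q"
    and "u dvd 1" "prod_list ps = u * prod_list qs" "ps \<noteq> []"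
  shows "qs \<noteq> [] \<and> ereal (real (length ps) / real (length qs)) \<le> elasticity TYPE('a)"
proof (cases qs)
  case Nil
  then have "prod_list ps dvd 1" using assms(3,4) by simp
  then show ?thesis using prod_list_irreducible_dvd_1_iff[OF assms(1)] assms(5) by simp
next
  case (Cons q qs')
  have "irreducible q" using assms(2) Cons by simp
  moreover have "u * q dvd q"
    using assms(3) by (metis dvd_refl mult_1 mult_dvd_mono)
  moreover have "\<not> u * q dvd 1" using \<open>irreducible q\<close>
    by (metis dvd_mult_right irreducible_not_unit)
  ultimately have "irreducible (u * q)" by (rule irreducible_mono)
  then have "\<forall>q\<in>set (u * q # qs'). irreducible q" using assms(2) Cons by simp
  moreover have "prod_list ps = prod_list (u * q # qs')"
    using assms(4) Cons by (simp add: mult.assoc)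
  ultimately show ?thesis
    using length_ratio_le_elasticity[OF assms(1), of "u * q # qs'"] assms(5) Cons by simp
qed

section \<open>Comparison of R with R[x]\<close>

text \<open>Atoms of R stay atoms as constant polynomials, so factorizations keep their lengths.
  This direction holds for every integral domain.\<close>

lemma elasticity_le_elasticity_poly: "elasticity TYPE('a::idom) \<le> elasticity TYPE('a poly)"
proof (rule elasticity_leI)
  fix ps qs :: "'a list"
  assume *: "\<forall>p\<in>set ps. irreducible p" "\<forall>q\<in>set qs. irreducible q"
    "prod_list ps = prod_list qs" "ps \<noteq> []"
  have const: "prod_list (map (\<lambda>c. [:c:]) xs) = [:prod_list xs:]" for xs :: "'a list"
    by (induction xs) (simp_all add: one_pCons)
  show "ereal (real (length ps) / real (length qs)) \<le> elasticity TYPE('a poly)"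
    using length_ratio_le_elasticity[of "map (\<lambda>c. [:c:]) ps" "map (\<lambda>c. [:c:]) qs"] *
    by (simp add: const irreducible_const_poly_iff)
qed

lemma add_ratio_le:
  fixes r t s :: real
  assumes "0 < t" "0 \<le> s"
  shows "(r + s) / (t + s) \<le> max 1 (r / t)"
proof (cases "r \<le> t")
  case True
  then have "(r + s) / (t + s) \<le> 1" using assms by simp
  then show ?thesis by simp
next
  case False
  then have "s * t \<le> s * r" using assms by (intro mult_left_mono) auto
  then have "(r + s) / (t + s) \<le> r / t" using assms by (simp add: field_simps)
  then show ?thesis by simp
qed

theorem theorem2p9:
  assumes "\<And>f :: 'a::idom poly. irreducible f \<Longrightarrow> degree f \<ge> 1 \<Longrightarrow> irreducible (map_poly to_fract f)"
    and "\<exists>p :: 'a. irreducible p"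
  shows "elasticity TYPE('a) = elasticity TYPE('a poly)"
proof (rule antisym[OF elasticity_le_elasticity_poly], rule elasticity_leI)
  fix ps qs :: "'a poly list"
  assume irr: "\<forall>p\<in>set ps. irreducible p" "\<forall>q\<in>set qs. irreducible q"
    and eq: "prod_list ps = prod_list qs"
  have one: "1 \<le> elasticity TYPE('a)" using assms(2) one_le_elasticity by blast
  obtain cs gs where c: "\<forall>c\<in>set cs. irreducible c" "\<forall>g\<in>set gs. irreducible g \<and> degree g \<ge> 1"
    "prod_list ps = smult (prod_list cs) (prod_list gs)" "length ps = length cs + length gs"
    using poly_factorization_split_constants[OF irr(1)] by blast
  obtain ds hs where d: "\<forall>d\<in>set ds. irreducible d" "\<forall>h\<in>set hs. irreducible h \<and> degree h \<ge> 1"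
    "prod_list qs = smult (prod_list ds) (prod_list hs)" "length qs = length ds + length hs"
    using poly_factorization_split_constants[OF irr(2)] by blast
  have "prod_list gs \<noteq> 0" using c(2) by (intro prod_list_irreducible_neq_0) auto
  obtain u where u: "length gs = length hs" "u dvd 1" "prod_list hs = smult u (prod_list gs)"
    using nonconstant_irreducible_lists_associated[OF assms(1) c(2) d(2)
        prod_list_irreducible_neq_0[OF c(1)] prod_list_irreducible_neq_0[OF d(1)]] c(3) d(3) eq
    by auto
  \<comment> \<open>Cancelling the common part of positive degree leaves two factorizations in R
    that agree up to the unit \<open>u\<close>.\<close>
  have "smult (prod_list cs) (prod_list gs) = smult (u * prod_list ds) (prod_list gs)"
    using c(3) d(3) eq u(3) by (simp add: mult.commute)
  then have "smult (prod_list cs - u * prod_list ds) (prod_list gs) = 0"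
    by (simp add: smult_diff_left)
  then have prod: "prod_list cs = u * prod_list ds" using \<open>prod_list gs \<noteq> 0\<close> by simp
  show "ereal (real (length ps) / real (length qs)) \<le> elasticity TYPE('a)"
  \<comment> \<open>Without constant atoms in \<open>ps\<close> the constant part is a unit, about
    which the elasticity of R says nothing; but then \<open>qs\<close> is at least as long as
    \<open>ps\<close>, and the bound 1 suffices.\<close>
  proof (cases "cs = []")
    case True
    then have "real (length ps) / real (length qs) \<le> 1"
      using c(4) d(4) u(1) by (simp add: divide_le_eq)
    then show ?thesis using one by (metis ereal_less_eq(3) one_ereal_def order_trans)
  next
    case False
    then have ds: "ds \<noteq> []" "ereal (real (length cs) / real (length ds)) \<le> elasticity TYPE('a)"
      using length_ratio_le_elasticity_associated[OF c(1) d(1) u(2) prod] by auto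
    \<comment> \<open>The equally many factors of positive degree on both sides are the common
      summand in \<open>add_ratio_le\<close>.\<close>
    have "real (length ps) / real (length qs) \<le> max 1 (real (length cs) / real (length ds))"
      using add_ratio_le[of "real (length ds)" "real (length hs)" "real (length cs)"] ds(1) c(4) d(4) u(1)
      by simp
    then have "ereal (real (length ps) / real (length qs))
        \<le> max 1 (ereal (real (length cs) / real (length ds)))"
      by (metis ereal_less_eq(3) ereal_max one_ereal_def)
    also have "\<dots> \<le> elasticity TYPE('a)" using ds(2) one by simp
    finally show ?thesis .
  qed
qed

end
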